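(* Let $a,b,c,\mu\in\mathbb{C}$ with $c,\,c-\mu\notin\mathbb{Z}_{\le0}$, $\operatorname{Re}\mu>0$, $\operatorname{Re}(c-a)>\operatorname{Re}\mu$ and $\operatorname{Re}(c-b)>\operatorname{Re}\mu$. Then for all real $x<1$ $$\int_{-\infty}^x(1-y)^{a+b-c}\,{}_2F_1(a,b;c;y)\,\frac{(x-y)^{\mu-1}}{\Gamma(\mu)}\,dy=\frac{\Gamma(c-a-\mu)}{\Gamma(c-a)}\,\frac{\Gamma(c-b-\mu)}{\Gamma(c-b)}\,\frac{\Gamma(c)}{\Gamma(c-\mu)}\,(1-x)^{a+b-c+\mu}\,{}_2F_1(a,b;c-\mu;x).$$
   Context: ${}_2F_1(a,b;c;z)$ denotes the Gauss hypergeometric function, defined for $|z|<1$ by $\sum_{k\ge0}\frac{(a)_k(b)_k}{(c)_k\,k!}z^k$ (with $c\notin\mathbb{Z}_{\le0}$) and extended by its one-valued analytic continuation to $\mathbb{C}\setminus[1,\infty)$. *)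

theory Defs
  imports "HOL-Complex_Analysis.Complex_Analysis"
begin

definition hyp2F1_domain :: "complex set" where
  "hyp2F1_domain = - (complex_of_real ` {1..})"

definition is_hyp2F1 :: "complex \<Rightarrow> complex \<Rightarrow> complex \<Rightarrow> (complex \<Rightarrow> complex) \<Rightarrow> bool" where
  "is_hyp2F1 a b c F \<longleftrightarrow>
     F holomorphic_on hyp2F1_domain \<and>
     (\<forall>z. norm z < 1 \<longrightarrow>
        (\<lambda>k. pochhammer a k * pochhammer b k / (pochhammer c k * fact k) * z ^ k) sums F z)"

text \<open>
  The value at \<open>z\<close> of the analytic continuation of the Gauss series to the cut plane.
  It is meaningful for \<open>z\<close> in the cut plane and \<open>c\<close> not a nonpositive integer;
  uniqueness of the continuation is \<open>is_hyp2F1_unique\<close>.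
\<close>
definition hyp2F1 :: "complex \<Rightarrow> complex \<Rightarrow> complex \<Rightarrow> complex \<Rightarrow> complex" where
  "hyp2F1 a b c z = (THE w. \<exists>F. is_hyp2F1 a b c F \<and> w = F z)"

lemma is_hyp2F1_unique:
  assumes F: "is_hyp2F1 a b c F" and G: "is_hyp2F1 a b c G" and z: "z \<in> hyp2F1_domain"
  shows "F z = G z"
proof -
  have op: "open hyp2F1_domain"
    unfolding hyp2F1_domain_def
    by (intro open_Compl closed_slot_right)
  have conn: "connected hyp2F1_domain"
    unfolding hyp2F1_domain_def
    by (intro starlike_imp_connected starlike_slotted_complex_plane_right)
  have sub: "ball 0 1 \<subseteq> hyp2F1_domain"
    by (auto simp: hyp2F1_domain_def)
  have eq: "F u = G u" if "u \<in> ball 0 1" for u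
    using F G that unfolding is_hyp2F1_def by (auto intro: sums_unique2)
  show ?thesis
    using analytic_continuation_open[of "ball 0 1" hyp2F1_domain F G z] op conn sub eq z F G
    by (auto simp: is_hyp2F1_def)
qed

lemma hyp2F1_eqI:
  assumes "is_hyp2F1 a b c F" and "z \<in> hyp2F1_domain"
  shows "hyp2F1 a b c z = F z"
  unfolding hyp2F1_def
  by (rule the_equality) (use assms is_hyp2F1_unique in blast)+

end

theory Submission
  imports Defs
begin

text \<open>
  Put \<open>\<alpha> = c - a\<close> and \<open>\<beta> = c - b\<close>. Euler's transformation absorbs the power of \<open>1 - y\<close> (and, on the
  right, that of \<open>1 - x\<close>), so that the claim says that the Weyl fractional integral of order \<open>\<mu>\<close> of
  \<open>F(\<alpha>, \<beta>; c; y)\<close> is a constant times \<open>F(\<alpha> - \<mu>, \<beta> - \<mu>; c - \<mu>; x)\<close>.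

  If \<open>Re c > Re \<beta>\<close>, then \<open>F\<close> is an Euler integral of powers \<open>(1 - t y)\<^bsup>-\<alpha>\<^esup>\<close>, whose Weyl
  integrals are Beta integrals, and Fubini's theorem gives the claim. The contiguous relation
  \<open>F(\<alpha>, \<beta>; c; y) = F(\<alpha>, \<beta>; c + 1; y) + \<alpha>\<beta> / (c (c + 1)) y F(\<alpha> + 1, \<beta> + 1; c + 2; y)\<close> then removes
  the restriction on \<open>c\<close> by induction, without any estimate of \<open>F\<close> at infinity. The same induction,
  together with one that raises \<open>\<beta>\<close>, shows that the analytic continuation exists.
\<close>

subsection \<open>Powers of the positive part\<close>

definition pos_powr :: "complex \<Rightarrow> real \<Rightarrow> complex" where
  "pos_powr z t = (if t > 0 then complex_of_real t powr z else 0)"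

lemma pos_powr_pos: "t > 0 \<Longrightarrow> pos_powr z t = complex_of_real t powr z"
  by (simp add: pos_powr_def)

lemma pos_powr_nonpos: "t \<le> 0 \<Longrightarrow> pos_powr z t = 0"
  by (simp add: pos_powr_def)

lemma pos_powr_1 [simp]: "pos_powr z 1 = 1"
  by (simp add: pos_powr_def)

lemma pos_powr_add: "pos_powr (z + w) t = pos_powr z t * pos_powr w t"
  by (simp add: pos_powr_def powr_add)

lemma pos_powr_mult: "s > 0 \<Longrightarrow> pos_powr z (s * t) = pos_powr z s * pos_powr z t"
  by (simp add: pos_powr_def zero_less_mult_iff powr_times_real)

lemma pos_powr_inverse: "pos_powr z (inverse t) = pos_powr (- z) t"
  by (simp add: pos_powr_def powr_def Ln_of_real ln_inverse flip: of_real_inverse)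

lemma pos_powr_uminus_mult_cancel: "t > 0 \<Longrightarrow> pos_powr (- z) t * pos_powr z t = 1"
  by (simp add: pos_powr_def flip: powr_add)

lemma of_real_norm_pos_powr: "complex_of_real (norm (pos_powr z t)) = pos_powr (of_real (Re z)) t"
  by (simp add: pos_powr_def norm_powr_real_powr powr_of_real)

lemma borel_measurable_powr_complex [measurable (raw)]:
  fixes f g :: "'a \<Rightarrow> complex"
  assumes [measurable]: "f \<in> borel_measurable M" "g \<in> borel_measurable M"
  shows "(\<lambda>x. f x powr g x) \<in> borel_measurable M"
  unfolding powr_def by measurable

lemma borel_measurable_pos_powr [measurable]: "pos_powr z \<in> borel_measurable borel"
  unfolding pos_powr_def by measurable

subsection \<open>Gamma and Beta integrals\<close>

lemma Re_pos_imp_not_nonpos_Ints: "Re z > 0 \<Longrightarrow> z \<notin> \<int>\<^sub>\<le>\<^sub>0"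
  by (auto elim!: nonpos_Ints_cases)

lemma Gamma_neq_0_Re_pos: "Re z > 0 \<Longrightarrow> Gamma z \<noteq> 0"
  by (simp add: Gamma_eq_zero_iff Re_pos_imp_not_nonpos_Ints)

lemma Beta_neq_0_Re_pos: "Re p > 0 \<Longrightarrow> Re q > 0 \<Longrightarrow> Beta p q \<noteq> 0"
  by (simp add: Beta_def Gamma_neq_0_Re_pos)

lemma has_bochner_integral_of_real_D:
  "has_bochner_integral M (\<lambda>x. complex_of_real (f x)) v \<Longrightarrow> has_bochner_integral M f (Re v)"
  using has_bochner_integral_bounded_linear[OF bounded_linear_Re] by fastforce

lemma (in pair_sigma_finite) has_bochner_integral_Fubini:
  fixes f :: "'a \<Rightarrow> 'b \<Rightarrow> 'c :: {banach, second_countable_topology}"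
  assumes [measurable]: "case_prod f \<in> borel_measurable (M1 \<Otimes>\<^sub>M M2)"
    and norm: "\<And>x. x \<in> space M1 \<Longrightarrow> has_bochner_integral M2 (\<lambda>y. norm (f x y)) (N x)" "integrable M1 N"
    and fst: "\<And>x. x \<in> space M1 \<Longrightarrow> has_bochner_integral M2 (f x) (g x)"
    and snd: "\<And>y. y \<in> space M2 \<Longrightarrow> has_bochner_integral M1 (\<lambda>x. f x y) (h y)"
    and iterated: "has_bochner_integral M1 g v"
  shows "has_bochner_integral M2 h v"
proof -
  have integrals: "(\<integral>y. norm (f x y) \<partial>M2) = N x" "(\<integral>y. f x y \<partial>M2) = g x" if "x \<in> space M1" for x
    using norm(1)[OF that] fst[OF that] by (simp_all add: has_bochner_integral_iff)
  have integrals_snd: "(\<integral>x. f x y \<partial>M1) = h y" if "y \<in> space M2" for y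
    using snd[OF that] by (simp add: has_bochner_integral_iff)
  have "integrable (M1 \<Otimes>\<^sub>M M2) (case_prod f)"
    using norm(2) fst
    by (intro Fubini_integrable)
       (auto simp: integrals has_bochner_integral_iff cong: Bochner_Integration.integrable_cong)
  from integrable_snd[OF this] Fubini_integral[OF this] iterated show ?thesis
    by (simp add: has_bochner_integral_iff integrals integrals_snd
          cong: Bochner_Integration.integrable_cong Bochner_Integration.integral_cong)
qed

lemma has_bochner_integral_Gamma:
  assumes "Re z > 0"
  shows "has_bochner_integral lborel (\<lambda>s. pos_powr (z - 1) s * of_real (exp (- s))) (Gamma z)"
proof -
  let ?f = "\<lambda>s. pos_powr (z - 1) s * of_real (exp (- s))"
  let ?g = "\<lambda>s. complex_of_real s powr (z - 1) / of_real (exp s)"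
  have f_eq: "?f s = indicator {0<..} s *\<^sub>R ?g s" for s
    by (simp add: pos_powr_def exp_minus divide_inverse)
  have integrable_g: "set_integrable lebesgue {0<..} ?g"
    using assms by (rule absolutely_integrable_Gamma_integral')
  then have "integrable lebesgue ?f"
    unfolding set_integrable_def f_eq .
  moreover have "integral\<^sup>L lebesgue ?f = Gamma z"
    using set_lebesgue_integral_eq_integral(2)[OF integrable_g] Gamma_integral_complex'[OF assms]
    unfolding set_lebesgue_integral_def f_eq by (simp add: integral_unique)
  moreover have "?f \<in> borel_measurable lborel"
    by measurable
  ultimately show ?thesis
    by (simp add: has_bochner_integral_iff integrable_completion integral_completion)
qed

lemma has_bochner_integral_Gamma_scaled:
  assumes "Re z > 0" "k > 0"
  shows "has_bochner_integral lborel (\<lambda>s. pos_powr (z - 1) s * of_real (exp (- (k * s))))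
    (Gamma z * pos_powr (- z) k)"
proof -
  have "has_bochner_integral lborel
      (\<lambda>s. pos_powr (1 - z) k * (pos_powr (z - 1) (0 + k * s) * of_real (exp (- (0 + k * s)))))
      (pos_powr (1 - z) k * (Gamma z /\<^sub>R \<bar>k\<bar>))"
    using has_bochner_integral_Gamma[OF assms(1)] assms(2)
    by (intro has_bochner_integral_mult_right)
       (subst (asm) lborel_has_bochner_integral_real_affine_iff[of k _ _ 0], auto)
  also have "(\<lambda>s. pos_powr (1 - z) k * (pos_powr (z - 1) (0 + k * s) * of_real (exp (- (0 + k * s))))) =
      (\<lambda>s. pos_powr (z - 1) s * of_real (exp (- (k * s))))"
    using assms(2) pos_powr_uminus_mult_cancel[of k "z - 1"]
    by (simp add: fun_eq_iff pos_powr_mult flip: mult.assoc)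
  also have "pos_powr (1 - z) k * (Gamma z /\<^sub>R \<bar>k\<bar>) = Gamma z * pos_powr (- z) k"
    using assms(2) pos_powr_add[of 1 "- z" k] by (simp add: pos_powr_pos scaleR_conv_of_real)
  finally show ?thesis .
qed

definition beta_kernel :: "real \<Rightarrow> real \<Rightarrow> complex \<Rightarrow> complex \<Rightarrow> real \<Rightarrow> real \<Rightarrow> complex" where
  "beta_kernel t d p q s v = pos_powr (p + q - 1) s * of_real (exp (- (d * s)))
     * (pos_powr (p - 1) v * of_real (exp (- (t * s * v))))"

lemma has_bochner_integral_beta_kernel_fst:
  assumes "Re p > 0" "t > 0"
  shows "has_bochner_integral lborel (beta_kernel t d p q s)
    (Gamma p * pos_powr (- p) t * (pos_powr (q - 1) s * of_real (exp (- (d * s)))))"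
proof (cases "s > 0")
  case True
  have "has_bochner_integral lborel (beta_kernel t d p q s)
      (pos_powr (p + q - 1) s * of_real (exp (- (d * s))) * (Gamma p * pos_powr (- p) (t * s)))"
    unfolding beta_kernel_def using assms True
    by (intro has_bochner_integral_mult_right has_bochner_integral_Gamma_scaled) auto
  also have "pos_powr (p + q - 1) s * of_real (exp (- (d * s))) * (Gamma p * pos_powr (- p) (t * s)) =
      Gamma p * pos_powr (- p) t * (pos_powr (q - 1) s * of_real (exp (- (d * s))))"
    unfolding pos_powr_mult[OF \<open>t > 0\<close>]
    using pos_powr_add[of "p + q - 1" "- p" s] by (simp add: mult_ac)
  finally show ?thesis .
qed (simp add: beta_kernel_def[abs_def] pos_powr_nonpos has_bochner_integral_zero)

lemma has_bochner_integral_beta_kernel_snd: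
  assumes "Re (p + q) > 0" "t > 0" "d > 0"
  shows "has_bochner_integral lborel (\<lambda>s. beta_kernel t d p q s v)
    (Gamma (p + q) * (pos_powr (p - 1) v * pos_powr (- (p + q)) (d + t * v)))"
proof (cases "v > 0")
  case True
  have "has_bochner_integral lborel
      (\<lambda>s. pos_powr (p - 1) v * (pos_powr (p + q - 1) s * of_real (exp (- ((d + t * v) * s)))))
      (pos_powr (p - 1) v * (Gamma (p + q) * pos_powr (- (p + q)) (d + t * v)))"
    using assms True
    by (intro has_bochner_integral_mult_right has_bochner_integral_Gamma_scaled)
       (auto simp: add_pos_pos)
  moreover have "exp (- ((d + t * v) * s)) = exp (- (d * s)) * exp (- (t * s * v))" for s
    by (simp add: algebra_simps flip: exp_add)
  ultimately show ?thesis
    by (simp add: beta_kernel_def mult_ac)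
qed (simp add: beta_kernel_def pos_powr_nonpos has_bochner_integral_zero)

lemma has_bochner_integral_Beta:
  assumes "Re p > 0" "Re q > 0" "t > 0" "d > 0"
  shows "has_bochner_integral lborel (\<lambda>v. pos_powr (p - 1) v * pos_powr (- (p + q)) (d + t * v))
    (Beta p q * (pos_powr (- p) t * pos_powr (- q) d))"
proof -
  define g where
    "g p q s = Gamma p * pos_powr (- p) t * (pos_powr (q - 1) s * of_real (exp (- (d * s))))" for p q s
  have fst: "has_bochner_integral lborel (beta_kernel t d p q s) (g p q s)" if "Re p > 0" for p q s
    unfolding g_def using that \<open>t > 0\<close> by (rule has_bochner_integral_beta_kernel_fst)
  have iterated: "has_bochner_integral lborel (g p q)
      (Gamma p * pos_powr (- p) t * (Gamma q * pos_powr (- q) d))" if "Re q > 0" for p q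
    unfolding g_def using that \<open>d > 0\<close>
    by (intro has_bochner_integral_mult_right has_bochner_integral_Gamma_scaled)
  have norm_eq: "complex_of_real (norm (beta_kernel t d p q s v)) =
      beta_kernel t d (Re p) (Re q) s v" for s v
    by (simp add: beta_kernel_def norm_mult of_real_norm_pos_powr)
  have "has_bochner_integral lborel
      (\<lambda>v. Gamma (p + q) * (pos_powr (p - 1) v * pos_powr (- (p + q)) (d + t * v)))
      (Gamma p * pos_powr (- p) t * (Gamma q * pos_powr (- q) d))"
  proof (rule lborel_pair.has_bochner_integral_Fubini
      [OF _ _ _ fst has_bochner_integral_beta_kernel_snd iterated])
    show "case_prod (beta_kernel t d p q) \<in> borel_measurable (lborel \<Otimes>\<^sub>M lborel)"
      unfolding beta_kernel_def by measurable
    show "has_bochner_integral lborel (\<lambda>v. norm (beta_kernel t d p q s v)) (Re (g (Re p) (Re q) s))" for s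
      using fst[of "Re p" "Re q" s] assms
      by (intro has_bochner_integral_of_real_D) (simp add: norm_eq)
    show "integrable lborel (\<lambda>s. Re (g (Re p) (Re q) s))"
      using iterated[of "Re q" "Re p"] assms
      by (intro integrable_Re) (simp add: has_bochner_integral_iff)
  qed (use assms in auto)
  from has_bochner_integral_mult_right[of "1 / Gamma (p + q)", OF this] show ?thesis
    using Gamma_neq_0_Re_pos[of "p + q"] assms by (simp add: Beta_def mult_ac)
qed

subsection \<open>Integrals depending on a complex parameter\<close>

lemma holomorphic_on_cball_lipschitz:
  assumes hol: "f holomorphic_on A" and "cball z0 (2 * r) \<subseteq> A" "r > 0"
    and bound: "\<And>z. z \<in> cball z0 (2 * r) \<Longrightarrow> norm (f z) \<le> B" and "z \<in> cball z0 r"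
  shows "norm (f z - f z0) \<le> B / r * norm (z - z0)"
proof (rule field_differentiable_bound)
  fix w assume "w \<in> cball z0 r"
  then have sub: "cball w r \<subseteq> cball z0 (2 * r)"
    by (simp add: cball_subset_cball_iff dist_commute)
  with assms(2) have subA: "cball w r \<subseteq> A" "ball w r \<subseteq> A"
    using ball_subset_cball by blast+
  then show "(f has_field_derivative deriv f w) (at w within cball z0 r)"
    using holomorphic_derivI[OF holomorphic_on_subset[OF hol subA(2)] open_ball] \<open>r > 0\<close> by simp
  have "norm (f u) \<le> B" if "norm (w - u) = r" for u
    using that sub by (intro bound) (auto simp: dist_norm)
  then show "norm (deriv f w) \<le> B / r"
    using Cauchy_inequality[of f w r B 1] hol subA \<open>r > 0\<close>
    by (simp add: holomorphic_on_subset holomorphic_on_imp_continuous_on)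
qed (use \<open>z \<in> cball z0 r\<close> \<open>r > 0\<close> in auto)

lemma has_field_derivative_integral:
  fixes f :: "'b \<Rightarrow> 'a \<Rightarrow> 'b :: {banach, real_normed_field, second_countable_topology}"
  assumes "r > 0" and integrable: "\<And>z. z \<in> ball z0 r \<Longrightarrow> integrable M (f z)"
    and deriv: "\<And>u. u \<in> space M \<Longrightarrow> ((\<lambda>z. f z u) has_field_derivative f' u) (at z0)"
    and lipschitz: "\<And>z u. z \<in> ball z0 r \<Longrightarrow> u \<in> space M \<Longrightarrow> norm (f z u - f z0 u) \<le> g u * norm (z - z0)"
    and dominating: "integrable M g"
  shows "((\<lambda>z. \<integral>u. f z u \<partial>M) has_field_derivative (\<integral>u. f' u \<partial>M)) (at z0)"
proof -
  define q where "q z u = (f z u - f z0 u) / (z - z0)" for z u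
  have q_le: "norm (q z u) \<le> g u" if "z \<in> ball z0 r" "z \<noteq> z0" "u \<in> space M" for z u
    using lipschitz[of z u] that by (simp add: q_def norm_divide divide_le_eq)
  have q_tendsto: "((\<lambda>z. q z u) \<longlongrightarrow> f' u) (at z0 within ball z0 r)" if "u \<in> space M" for u
    using has_field_derivative_at_within[OF deriv[OF that]]
    by (simp add: q_def has_field_derivative_iff)
  have "((\<lambda>z. ((\<integral>u. f z u \<partial>M) - (\<integral>u. f z0 u \<partial>M)) / (z - z0)) \<longlongrightarrow> (\<integral>u. f' u \<partial>M))
      (at z0 within ball z0 r)"
    unfolding tendsto_at_iff_sequentially
  proof (intro allI impI)
    fix X assume X: "\<forall>i. X i \<in> ball z0 r - {z0}" "X \<longlonglongrightarrow> z0"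
    then have X_in: "X i \<in> ball z0 r" "X i \<noteq> z0" for i
      by auto
    have q_meas: "q (X i) \<in> borel_measurable M" for i
      unfolding q_def using integrable[OF X_in(1)] integrable[of z0] \<open>r > 0\<close>
      by (intro borel_measurable_integrable) auto
    have q_lim: "(\<lambda>i. q (X i) u) \<longlonglongrightarrow> f' u" if "u \<in> space M" for u
      using q_tendsto[OF that] X unfolding tendsto_at_iff_sequentially comp_def by blast
    have "(\<lambda>i. \<integral>u. q (X i) u \<partial>M) \<longlonglongrightarrow> (\<integral>u. f' u \<partial>M)"
      using dominating q_lim q_le[OF X_in]
      by (intro integral_dominated_convergence[where w = g] q_meas AE_I2
          borel_measurable_LIMSEQ_metric[OF q_meas q_lim]) auto
    also have "(\<lambda>i. \<integral>u. q (X i) u \<partial>M) = (\<lambda>i. ((\<integral>u. f (X i) u \<partial>M) - (\<integral>u. f z0 u \<partial>M)) / (X i - z0))"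
      using integrable[OF X_in(1)] integrable[of z0] \<open>r > 0\<close> by (simp add: q_def)
    finally show "((\<lambda>z. ((\<integral>u. f z u \<partial>M) - (\<integral>u. f z0 u \<partial>M)) / (z - z0)) \<circ> X) \<longlonglongrightarrow> (\<integral>u. f' u \<partial>M)"
      by (simp add: comp_def)
  qed
  then show ?thesis
    using \<open>r > 0\<close> at_within_open[of z0 "ball z0 r"] by (simp add: has_field_derivative_iff)
qed

lemma holomorphic_on_integral:
  fixes f :: "complex \<Rightarrow> 'a \<Rightarrow> complex"
  assumes "open A" and hol: "\<And>u. u \<in> space M \<Longrightarrow> (\<lambda>z. f z u) holomorphic_on A"
    and integrable: "\<And>z. z \<in> A \<Longrightarrow> integrable M (f z)"
    and dominated: "\<And>K. compact K \<Longrightarrow> K \<subseteq> A \<Longrightarrow>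
      \<exists>g. integrable M g \<and> (\<forall>z\<in>K. \<forall>u\<in>space M. norm (f z u) \<le> g u)"
  shows "(\<lambda>z. \<integral>u. f z u \<partial>M) holomorphic_on A"
  unfolding holomorphic_on_open[OF \<open>open A\<close>]
proof
  fix z0 assume "z0 \<in> A"
  then obtain \<epsilon> where "\<epsilon> > 0" "cball z0 \<epsilon> \<subseteq> A"
    using \<open>open A\<close> open_contains_cball by blast
  then obtain r where r: "r > 0" "cball z0 (2 * r) \<subseteq> A"
    using that[of "\<epsilon> / 2"] by simp
  obtain g where g: "integrable M g"
    "\<And>z u. z \<in> cball z0 (2 * r) \<Longrightarrow> u \<in> space M \<Longrightarrow> norm (f z u) \<le> g u"
    using dominated[OF compact_cball r(2)] by blast
  have "((\<lambda>z. \<integral>u. f z u \<partial>M) has_field_derivative (\<integral>u. deriv (\<lambda>z. f z u) z0 \<partial>M)) (at z0)"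
  proof (rule has_field_derivative_integral[OF r(1)])
    fix z u assume "z \<in> ball z0 r" "u \<in> space M"
    then show "norm (f z u - f z0 u) \<le> g u / r * norm (z - z0)"
      using holomorphic_on_cball_lipschitz[OF hol r(2,1) g(2)] by simp
  qed (use g(1) r in \<open>auto intro!: integrable holomorphic_derivI[OF hol \<open>open A\<close> \<open>z0 \<in> A\<close>]\<close>)
  then show "\<exists>D. ((\<lambda>z. \<integral>u. f z u \<partial>M) has_field_derivative D) (at z0)" ..
qed

lemma sums_integral_power_series:
  fixes w \<tau> :: "'a \<Rightarrow> 'b :: {banach, real_normed_field, second_countable_topology}"
  assumes integrable_w: "integrable M w" and [measurable]: "\<tau> \<in> borel_measurable M"
    and norm_\<tau>: "\<And>u. u \<in> space M \<Longrightarrow> norm (\<tau> u) \<le> 1" and summable_t: "summable (\<lambda>k. norm (t k))"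
  shows "(\<lambda>k. t k * (\<integral>u. w u * \<tau> u ^ k \<partial>M)) sums (\<integral>u. w u * (\<Sum>k. t k * \<tau> u ^ k) \<partial>M)"
proof -
  have [measurable]: "w \<in> borel_measurable M"
    using integrable_w by auto
  define f where "f k u = w u * (t k * \<tau> u ^ k)" for k u
  have f_le: "norm (f k u) \<le> norm (t k) * norm (w u)" if "u \<in> space M" for k u
    using norm_\<tau>[OF that] mult_left_le[of "norm (\<tau> u) ^ k" "norm (t k) * norm (w u)"]
    by (simp add: f_def norm_mult norm_power power_le_one mult_ac)
  have integrable_f: "integrable M (f k)" for k
    using integrable_mult_right[OF integrable_norm[OF integrable_w], of "norm (t k)"]
    by (rule Bochner_Integration.integrable_bound) (use f_le in \<open>auto simp: f_def[abs_def]\<close>)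
  have summable_f: "summable (\<lambda>k. norm (f k u))" if "u \<in> space M" for u
    using f_le[OF that] by (intro summable_comparison_test'[OF summable_mult2[OF summable_t]]) auto
  have "(\<lambda>k. integral\<^sup>L M (f k)) sums (\<integral>u. (\<Sum>k. f k u) \<partial>M)"
  proof (intro sums_integral integrable_f AE_I2 summable_f)
    have "(\<integral>u. norm (f k u) \<partial>M) \<le> (\<integral>u. norm (t k) * norm (w u) \<partial>M)" for k
      using f_le integrable_w integrable_f by (intro integral_mono) auto
    then show "summable (\<lambda>k. \<integral>u. norm (f k u) \<partial>M)"
      by (intro summable_comparison_test'
          [OF summable_mult2[OF summable_t, of "\<integral>u. norm (w u) \<partial>M"]]) simp
  qed
  moreover have "(\<Sum>k. f k u) = w u * (\<Sum>k. t k * \<tau> u ^ k)" if "u \<in> space M" for u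
  proof (cases "w u = 0")
    case False
    have "summable (\<lambda>k. t k * \<tau> u ^ k)"
      using summable_norm_cancel[OF summable_f[OF that]] False by (simp add: f_def)
    then show ?thesis
      by (simp add: f_def suminf_mult)
  qed (simp add: f_def)
  moreover have "integral\<^sup>L M (f k) = t k * (\<integral>u. w u * \<tau> u ^ k \<partial>M)" for k
    by (simp add: f_def[abs_def] mult.left_commute)
  ultimately show ?thesis
    by (simp cong: Bochner_Integration.integral_cong)
qed

subsection \<open>Euler's integral\<close>

lemma open_hyp2F1_domain: "open hyp2F1_domain"
  unfolding hyp2F1_domain_def by (intro open_Compl closed_slot_right)

lemma of_real_in_hyp2F1_domain: "x < 1 \<Longrightarrow> complex_of_real x \<in> hyp2F1_domain"
  by (auto simp: hyp2F1_domain_def)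

lemma norm_less_1_imp_in_hyp2F1_domain: "norm z < 1 \<Longrightarrow> z \<in> hyp2F1_domain"
  by (auto simp: hyp2F1_domain_def)

lemma one_minus_mult_notin_nonpos_Reals:
  assumes "z \<in> hyp2F1_domain" "s \<in> {0..1}"
  shows "1 - z * complex_of_real s \<notin> \<real>\<^sub>\<le>\<^sub>0"
proof
  assume "1 - z * complex_of_real s \<in> \<real>\<^sub>\<le>\<^sub>0"
  then obtain r where r: "1 - z * complex_of_real s = of_real r" "r \<le> 0"
    by (auto elim: nonpos_Reals_cases)
  then have "s > 0"
    using assms by (cases "s = 0") auto
  with r have "z = complex_of_real ((1 - r) / s)"
    by (simp add: field_simps)
  moreover have "(1 - r) / s \<ge> 1"
    using r \<open>s > 0\<close> assms(2) by (auto simp: field_simps)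
  ultimately show False
    using assms(1) by (auto simp: hyp2F1_domain_def simp del: of_real_divide)
qed

lemma one_minus_mult_powr_bounded:
  assumes "compact K" "K \<subseteq> hyp2F1_domain"
  obtains C where "\<And>z s. z \<in> K \<Longrightarrow> s \<in> {0..1} \<Longrightarrow> norm ((1 - z * complex_of_real s) powr p) \<le> C"
proof -
  let ?k = "\<lambda>(z, s). (1 - z * complex_of_real s) powr p"
  have "continuous_on (- \<real>\<^sub>\<le>\<^sub>0) (\<lambda>w. w powr p)"
    by (intro holomorphic_on_imp_continuous_on holomorphic_intros) auto
  then have "continuous_on (K \<times> {0..1}) ?k"
    unfolding case_prod_unfold
    by (rule continuous_on_compose2)
       (use assms(2) one_minus_mult_notin_nonpos_Reals in
         \<open>auto intro!: continuous_intros simp del: atLeastAtMost_iff\<close>)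
  then have "bounded (?k ` (K \<times> {0..1}))"
    by (intro compact_imp_bounded compact_continuous_image compact_Times assms(1)) auto
  then show ?thesis
    using that unfolding bounded_iff by fastforce
qed

lemma one_minus_mult_powr_dominated:
  fixes w :: "'a \<Rightarrow> complex"
  assumes "integrable M w" and "\<And>u. u \<in> space M \<Longrightarrow> \<tau> u \<in> {0..1}"
    and "compact K" "K \<subseteq> hyp2F1_domain"
  shows "\<exists>g. integrable M g \<and>
    (\<forall>z\<in>K. \<forall>u\<in>space M. norm (w u * (1 - z * complex_of_real (\<tau> u)) powr p) \<le> g u)"
proof -
  obtain C where "\<And>z s. z \<in> K \<Longrightarrow> s \<in> {0..1} \<Longrightarrow> norm ((1 - z * complex_of_real s) powr p) \<le> C"
    using one_minus_mult_powr_bounded[OF assms(3,4)] by blast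
  then show ?thesis
    using assms(1,2)
    by (intro exI[of _ "\<lambda>u. norm (w u) * C"]) (auto simp: norm_mult intro!: mult_left_mono)
qed

lemma integrable_one_minus_mult_powr:
  fixes w :: "'a \<Rightarrow> complex"
  assumes integrable_w: "integrable M w"
    and \<tau>: "\<tau> \<in> borel_measurable M" "\<And>u. u \<in> space M \<Longrightarrow> \<tau> u \<in> {0..1}" and "z \<in> hyp2F1_domain"
  shows "integrable M (\<lambda>u. w u * (1 - z * complex_of_real (\<tau> u)) powr p)"
proof -
  note [measurable] = borel_measurable_integrable[OF integrable_w] \<tau>(1)
  obtain g where g: "integrable M g"
    "\<And>u. u \<in> space M \<Longrightarrow> norm (w u * (1 - z * complex_of_real (\<tau> u)) powr p) \<le> g u"
    using one_minus_mult_powr_dominated[OF integrable_w, of \<tau> "{z}" p] \<tau>(2) assms(4) by auto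
  show ?thesis
    by (rule Bochner_Integration.integrable_bound[OF g(1)])
      (use g(2) in \<open>auto intro!: AE_I2 order_trans[OF _ abs_ge_self]\<close>)
qed

lemma holomorphic_on_integral_one_minus_mult_powr:
  assumes "integrable M w" and "\<tau> \<in> borel_measurable M" "\<And>u. u \<in> space M \<Longrightarrow> \<tau> u \<in> {0..1}"
  shows "(\<lambda>z. \<integral>u. w u * (1 - z * complex_of_real (\<tau> u)) powr p \<partial>M) holomorphic_on hyp2F1_domain"
  by (intro holomorphic_on_integral open_hyp2F1_domain integrable_one_minus_mult_powr
      one_minus_mult_powr_dominated holomorphic_intros)
    (use assms one_minus_mult_notin_nonpos_Reals in auto)

lemma binomial_series_one_minus_powr:
  fixes a z :: complex
  assumes "norm z < 1"
  shows "(\<lambda>k. pochhammer a k / fact k * z ^ k) sums (1 - z) powr (- a)"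
proof -
  have "(- a gchoose k) * (- z) ^ k = pochhammer a k / fact k * z ^ k" for k
  proof -
    have "(- a gchoose k) * (- z) ^ k = pochhammer a k / fact k * ((- 1) ^ k * (- z) ^ k)"
      by (simp add: gbinomial_pochhammer)
    then show ?thesis
      by (simp flip: power_mult_distrib)
  qed
  then show ?thesis
    using gen_binomial_complex[of "- z" "- a"] assms by simp
qed

definition euler_weight :: "complex \<Rightarrow> complex \<Rightarrow> real \<Rightarrow> complex" where
  "euler_weight b c u = pos_powr (b - 1) u * pos_powr (- c) (1 + u)"

definition euler_ratio :: "real \<Rightarrow> real" where
  "euler_ratio u = (if u > 0 then u / (1 + u) else 0)"

text \<open>Euler's integral over \<open>[0, 1]\<close> after the substitution \<open>t = u / (1 + u)\<close>.\<close>
definition euler_integral :: "complex \<Rightarrow> complex \<Rightarrow> complex \<Rightarrow> complex \<Rightarrow> complex" where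
  "euler_integral a b c z =
     (\<integral>u. euler_weight b c u * (1 - z * complex_of_real (euler_ratio u)) powr (- a) \<partial>lborel)
       / Beta b (c - b)"

lemma borel_measurable_euler_weight [measurable]: "euler_weight b c \<in> borel_measurable borel"
  unfolding euler_weight_def by measurable

lemma borel_measurable_euler_ratio [measurable]: "euler_ratio \<in> borel_measurable borel"
  unfolding euler_ratio_def by measurable

lemma euler_ratio_in_unit_interval: "euler_ratio u \<in> {0..1}"
  by (auto simp: euler_ratio_def field_simps)

lemma has_bochner_integral_euler_weight:
  assumes "Re b > 0" "Re c > Re b"
  shows "has_bochner_integral lborel (euler_weight b c) (Beta b (c - b))"
  using has_bochner_integral_Beta[of b "c - b" 1 1] assms by (simp add: euler_weight_def[abs_def])

lemma integrable_euler_weight: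
  "Re b > 0 \<Longrightarrow> Re c > Re b \<Longrightarrow> integrable lborel (euler_weight b c)"
  using has_bochner_integral_euler_weight by (simp add: has_bochner_integral_iff)

lemma euler_weight_mult_pos_powr_ratio:
  "euler_weight b c u * pos_powr p (euler_ratio u) = euler_weight (b + p) (c + p) u"
proof (cases "u > 0")
  case True
  then have "pos_powr p (euler_ratio u) = pos_powr p u * pos_powr (- p) (1 + u)"
    by (simp add: euler_ratio_def divide_inverse pos_powr_mult pos_powr_inverse)
  then show ?thesis
    using pos_powr_add[of "b - 1" p u] pos_powr_add[of "- c" "- p" "1 + u"]
    by (simp add: euler_weight_def algebra_simps)
qed (simp add: euler_weight_def pos_powr_nonpos)

lemma euler_weight_mult_ratio_power:
  "euler_weight b c u * complex_of_real (euler_ratio u) ^ k =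
    euler_weight (b + of_nat k) (c + of_nat k) u"
proof (cases "u > 0")
  case True
  then have "euler_ratio u > 0"
    by (simp add: euler_ratio_def)
  then show ?thesis
    by (simp add: pos_powr_pos flip: euler_weight_mult_pos_powr_ratio)
qed (simp add: euler_weight_def pos_powr_nonpos)

lemma Beta_plus_of_nat:
  fixes p q :: "'a :: Gamma"
  assumes "p \<notin> \<int>\<^sub>\<le>\<^sub>0" "q \<notin> \<int>\<^sub>\<le>\<^sub>0" "p + q \<notin> \<int>\<^sub>\<le>\<^sub>0"
  shows "Beta (p + of_nat k) q = pochhammer p k / pochhammer (p + q) k * Beta p q"
  using assms by (simp add: Beta_def pochhammer_Gamma Gamma_eq_zero_iff add_ac)

lemma euler_integral_sums:
  assumes "Re b > 0" "Re c > Re b" "norm z < 1"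
  shows "(\<lambda>k. pochhammer a k * pochhammer b k / (pochhammer c k * fact k) * z ^ k) sums
    euler_integral a b c z"
proof -
  define t where "t k = pochhammer a k / fact k * z ^ k" for k
  obtain r where r: "norm z < r" "r < 1"
    using dense assms(3) by blast
  have "r > 0"
    using r(1) norm_ge_zero le_less_trans by blast
  then have "summable (\<lambda>k. pochhammer a k / fact k * complex_of_real r ^ k)"
    using r(2) by (intro sums_summable[OF binomial_series_one_minus_powr]) auto
  from powser_insidea[OF this, of z] have summable_t: "summable (\<lambda>k. norm (t k))"
    using r \<open>r > 0\<close> by (simp add: t_def)
  have "(\<lambda>k. t k * (\<integral>u. euler_weight b c u * complex_of_real (euler_ratio u) ^ k \<partial>lborel)) sums
      (\<integral>u. euler_weight b c u * (\<Sum>k. t k * complex_of_real (euler_ratio u) ^ k) \<partial>lborel)"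
    using euler_ratio_in_unit_interval
    by (intro sums_integral_power_series integrable_euler_weight assms(1,2) summable_t) auto
  moreover have "(\<integral>u. euler_weight b c u * complex_of_real (euler_ratio u) ^ k \<partial>lborel) =
      pochhammer b k / pochhammer c k * Beta b (c - b)" for k
    using has_bochner_integral_euler_weight[of "b + of_nat k" "c + of_nat k"]
      Beta_plus_of_nat[of b "c - b" k] assms
    by (simp add: euler_weight_mult_ratio_power has_bochner_integral_iff Re_pos_imp_not_nonpos_Ints)
  moreover have "(\<Sum>k. t k * complex_of_real (euler_ratio u) ^ k) =
      (1 - z * complex_of_real (euler_ratio u)) powr (- a)" for u
  proof -
    have "norm (z * complex_of_real (euler_ratio u)) < 1"
      using euler_ratio_in_unit_interval[of u] assms(3) mult_left_le[of "euler_ratio u" "norm z"]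
      by (simp add: norm_mult)
    from binomial_series_one_minus_powr[OF this] show ?thesis
      by (simp add: t_def power_mult_distrib sums_iff mult_ac)
  qed
  moreover have "Beta b (c - b) \<noteq> 0"
    using assms by (simp add: Beta_neq_0_Re_pos)
  ultimately show ?thesis
    unfolding euler_integral_def
    by (auto dest: sums_divide[of _ _ "Beta b (c - b)"] simp: t_def mult_ac)
qed

lemma is_hyp2F1_euler_integral:
  assumes "Re b > 0" "Re c > Re b"
  shows "is_hyp2F1 a b c (euler_integral a b c)"
  unfolding is_hyp2F1_def
proof (intro conjI allI impI)
  have "Beta b (c - b) \<noteq> 0"
    using assms by (simp add: Beta_neq_0_Re_pos)
  then show "euler_integral a b c holomorphic_on hyp2F1_domain"
    unfolding euler_integral_def using euler_ratio_in_unit_interval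
    by (intro holomorphic_intros holomorphic_on_integral_one_minus_mult_powr
        integrable_euler_weight assms) auto
qed (rule euler_integral_sums[OF assms])

subsection \<open>Contiguous relations and the existence of the continuation\<close>

abbreviation hyp2F1_fps :: "'a \<Rightarrow> 'a \<Rightarrow> 'a \<Rightarrow> 'a :: field_char_0 fps" where
  "hyp2F1_fps a b c \<equiv> fps_hypergeo [a, b] [c] 1"

lemma fps_nth_hyp2F1_fps:
  "fps_nth (hyp2F1_fps a b c) n = pochhammer a n * pochhammer b n / (pochhammer c n * fact n)"
  by simp

lemma has_fps_expansion_unit_discI:
  fixes f :: "complex \<Rightarrow> complex"
  assumes "\<And>z. norm z < 1 \<Longrightarrow> (\<lambda>n. fps_nth F n * z ^ n) sums f z"
  shows "f has_fps_expansion F"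
proof (rule has_fps_expansionI)
  have "eventually (\<lambda>z :: complex. norm z < 1) (nhds 0)"
    using eventually_nhds_in_open[of "ball 0 1" "0 :: complex"] by simp
  then show "eventually (\<lambda>z. (\<lambda>n. fps_nth F n * z ^ n) sums f z) (nhds 0)"
    by (rule eventually_mono) (rule assms)
qed

lemma is_hyp2F1_iff_has_fps_expansion:
  "is_hyp2F1 a b c F \<longleftrightarrow> F holomorphic_on hyp2F1_domain \<and> F has_fps_expansion hyp2F1_fps a b c"
proof (intro iffI conjI)
  assume F: "is_hyp2F1 a b c F"
  then show "F holomorphic_on hyp2F1_domain"
    by (simp add: is_hyp2F1_def)
  show "F has_fps_expansion hyp2F1_fps a b c"
    using F by (intro has_fps_expansion_unit_discI) (simp add: is_hyp2F1_def)
next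
  assume F: "F holomorphic_on hyp2F1_domain \<and> F has_fps_expansion hyp2F1_fps a b c"
  then have "F holomorphic_on eball 0 1"
    by (auto simp: norm_less_1_imp_in_hyp2F1_domain intro: holomorphic_on_subset)
  then show "is_hyp2F1 a b c F"
    using F has_fps_expansion_imp_sums_complex[of F "hyp2F1_fps a b c" 1]
    by (simp add: is_hyp2F1_def)
qed

lemma not_nonpos_Ints_plus1: "z \<notin> \<int>\<^sub>\<le>\<^sub>0 \<Longrightarrow> z + 1 \<notin> \<int>\<^sub>\<le>\<^sub>0"
  using plus_one_in_nonpos_Ints_imp by blast

lemma not_nonpos_Ints_plus2: "z \<notin> \<int>\<^sub>\<le>\<^sub>0 \<Longrightarrow> z + 2 \<notin> \<int>\<^sub>\<le>\<^sub>0"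
  using not_nonpos_Ints_plus1[of z] not_nonpos_Ints_plus1[of "z + 1"] by (simp add: add.assoc)

lemma hyp2F1_fps_raise_b:
  "hyp2F1_fps a b c =
     hyp2F1_fps a (b + 1) c + fps_const (- a / c) * fps_X * hyp2F1_fps (a + 1) (b + 1) (c + 1)"
proof (rule fps_ext)
  fix n show "fps_nth (hyp2F1_fps a b c) n = fps_nth (hyp2F1_fps a (b + 1) c
      + fps_const (- a / c) * fps_X * hyp2F1_fps (a + 1) (b + 1) (c + 1)) n"
  proof (cases n)
    case (Suc k)
    have "pochhammer (b + 1) (Suc k) = pochhammer (b + 1) k * (b + of_nat (Suc k))"
      by (simp add: pochhammer_Suc add_ac)
    then show ?thesis
      by (simp add: Suc fps_nth_hyp2F1_fps mult.assoc pochhammer_rec[of a] pochhammer_rec[of b]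
            pochhammer_rec[of c] divide_simps del: of_nat_Suc fps_hypergeo_nth)
         (simp add: algebra_simps del: of_nat_Suc)
  qed simp
qed

lemma hyp2F1_fps_raise_c:
  assumes "c \<notin> \<int>\<^sub>\<le>\<^sub>0"
  shows "hyp2F1_fps a b c = hyp2F1_fps a b (c + 1)
    + fps_const (a * b / (c * (c + 1))) * fps_X * hyp2F1_fps (a + 1) (b + 1) (c + 2)"
proof (rule fps_ext)
  fix n show "fps_nth (hyp2F1_fps a b c) n = fps_nth (hyp2F1_fps a b (c + 1)
      + fps_const (a * b / (c * (c + 1))) * fps_X * hyp2F1_fps (a + 1) (b + 1) (c + 2)) n"
  proof (cases n)
    case (Suc k)
    have neq_0: "c \<noteq> 0" "c + 1 \<noteq> 0" "c + of_nat (Suc k) \<noteq> 0" "pochhammer (c + 1) k \<noteq> 0"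
      using assms not_nonpos_Ints_plus1[OF assms] plus_of_nat_eq_0_imp[of c "Suc k"]
        pochhammer_eq_0_imp_nonpos_Int[of "c + 1" k] by (auto simp del: of_nat_Suc)
    have shift1: "pochhammer (c + 1) (Suc k) = pochhammer (c + 1) k * (c + of_nat (Suc k))"
      by (simp add: pochhammer_Suc add_ac)
    then have shift2: "pochhammer (c + 2) k = pochhammer (c + 1) k * (c + of_nat (Suc k)) / (c + 1)"
      using neq_0 pochhammer_rec[of "c + 1" k] by (simp add: field_simps del: of_nat_Suc)
    then show ?thesis
      using neq_0
      by (simp add: Suc fps_nth_hyp2F1_fps mult.assoc pochhammer_rec[of a] pochhammer_rec[of b]
            pochhammer_rec[of c] shift1 shift2 divide_simps del: of_nat_Suc fps_hypergeo_nth)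
         (simp add: algebra_simps del: of_nat_Suc)
  qed simp
qed

lemma is_hyp2F1_contiguous:
  assumes "is_hyp2F1 a' b' c' F" and "is_hyp2F1 a'' b'' c'' G"
    and "hyp2F1_fps a b c = hyp2F1_fps a' b' c' + fps_const k * fps_X * hyp2F1_fps a'' b'' c''"
  shows "is_hyp2F1 a b c (\<lambda>z. F z + k * z * G z)"
  using assms unfolding is_hyp2F1_iff_has_fps_expansion
  by (auto intro!: holomorphic_intros fps_expansion_intros)

lemma ex_is_hyp2F1_Re_pos:
  assumes "Re b > 0" "c \<notin> \<int>\<^sub>\<le>\<^sub>0"
  shows "\<exists>F. is_hyp2F1 a b c F"
proof -
  obtain n where "Re b - Re c < real n"
    using reals_Archimedean2 by blast
  then have "Re b < Re c + real n"
    by simp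
  then show ?thesis
    using assms
  proof (induction n arbitrary: a b c)
    case 0
    then show ?case
      using is_hyp2F1_euler_integral by auto
  next
    case (Suc n)
    obtain F G where "is_hyp2F1 a b (c + 1) F" "is_hyp2F1 (a + 1) (b + 1) (c + 2) G"
      using Suc.IH[of b "c + 1" a] Suc.IH[of "b + 1" "c + 2" "a + 1"] Suc.prems
      by (auto simp: not_nonpos_Ints_plus1 not_nonpos_Ints_plus2)
    from is_hyp2F1_contiguous[OF this hyp2F1_fps_raise_c] Suc.prems show ?case
      by blast
  qed
qed

lemma ex_is_hyp2F1:
  assumes "c \<notin> \<int>\<^sub>\<le>\<^sub>0"
  shows "\<exists>F. is_hyp2F1 a b c F"
proof -
  obtain n where "- Re b < real n"
    using reals_Archimedean2 by blast
  then have "Re b + real n > 0"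
    by simp
  then show ?thesis
    using assms
  proof (induction n arbitrary: a b c)
    case 0
    then show ?case
      using ex_is_hyp2F1_Re_pos by simp
  next
    case (Suc n)
    obtain F G where "is_hyp2F1 a (b + 1) c F" "is_hyp2F1 (a + 1) (b + 1) (c + 1) G"
      using Suc.IH[of "b + 1" c a] Suc.IH[of "b + 1" "c + 1" "a + 1"] Suc.prems
      by (auto simp: not_nonpos_Ints_plus1)
    from is_hyp2F1_contiguous[OF this hyp2F1_fps_raise_b] show ?case
      by blast
  qed
qed

lemma is_hyp2F1_hyp2F1:
  assumes "c \<notin> \<int>\<^sub>\<le>\<^sub>0"
  shows "is_hyp2F1 a b c (hyp2F1 a b c)"
proof -
  obtain F where F: "is_hyp2F1 a b c F"
    using ex_is_hyp2F1[OF assms] by blast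
  then show ?thesis
    using hyp2F1_eqI[OF F] unfolding is_hyp2F1_def
    by (auto simp: norm_less_1_imp_in_hyp2F1_domain cong: holomorphic_cong)
qed

lemma hyp2F1_raise_c:
  assumes "c \<notin> \<int>\<^sub>\<le>\<^sub>0" "z \<in> hyp2F1_domain"
  shows "hyp2F1 a b c z = hyp2F1 a b (c + 1) z
    + a * b / (c * (c + 1)) * z * hyp2F1 (a + 1) (b + 1) (c + 2) z"
  using assms
  by (intro hyp2F1_eqI is_hyp2F1_contiguous[OF is_hyp2F1_hyp2F1 is_hyp2F1_hyp2F1 hyp2F1_fps_raise_c])
     (simp_all add: not_nonpos_Ints_plus1 not_nonpos_Ints_plus2)

subsection \<open>Euler's transformation\<close>

definition hyp2F1_ode :: "'a \<Rightarrow> 'a \<Rightarrow> 'a \<Rightarrow> 'a :: field_char_0 fps \<Rightarrow> 'a fps" where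
  "hyp2F1_ode a b c y = fps_X * (1 - fps_X) * fps_deriv (fps_deriv y)
     + (fps_const c - (fps_const a + fps_const b + 1) * fps_X) * fps_deriv y
     - fps_const a * fps_const b * y"

lemma fps_nth_hyp2F1_ode:
  "fps_nth (hyp2F1_ode a b c y) n = of_nat (Suc n) * (c + of_nat n) * fps_nth y (Suc n)
     - (a + of_nat n) * (b + of_nat n) * fps_nth y n"
proof -
  have expand: "hyp2F1_ode a b c y =
      fps_X * fps_deriv (fps_deriv y) - fps_X * (fps_X * fps_deriv (fps_deriv y))
      + fps_const c * fps_deriv y - fps_const (a + b + 1) * (fps_X * fps_deriv y)
      - fps_const (a * b) * y"
    by (simp add: hyp2F1_ode_def algebra_simps flip: fps_const_add)
  consider "n = 0" | "n = 1" | m where "n = Suc (Suc m)"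
    by (metis One_nat_def not0_implies_Suc)
  then show ?thesis
    by cases (simp_all add: expand algebra_simps)
qed

lemma hyp2F1_ode_eq_0_iff:
  assumes "c \<notin> \<int>\<^sub>\<le>\<^sub>0" and "fps_nth y 0 = 1"
  shows "hyp2F1_ode a b c y = 0 \<longleftrightarrow> y = hyp2F1_fps a b c"
proof -
  define \<rho> where "\<rho> n = (a + of_nat n) * (b + of_nat n) / (of_nat (Suc n) * (c + of_nat n))" for n
  have "of_nat (Suc n) * (c + of_nat n) \<noteq> 0" for n
    using assms(1) plus_of_nat_eq_0_imp[of c n] by (auto simp del: of_nat_Suc)
  then have ode_iff: "hyp2F1_ode a b c y = 0 \<longleftrightarrow> (\<forall>n. fps_nth y (Suc n) = \<rho> n * fps_nth y n)"
    by (simp add: \<rho>_def fps_eq_iff fps_nth_hyp2F1_ode eq_divide_eq mult_ac del: of_nat_Suc)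
  have hyp2F1_fps_Suc: "fps_nth (hyp2F1_fps a b c) (Suc n) = \<rho> n * fps_nth (hyp2F1_fps a b c) n" for n
    unfolding fps_hypergeo_rec \<rho>_def by simp
  show ?thesis
  proof
    assume "hyp2F1_ode a b c y = 0"
    then have "fps_nth y n = fps_nth (hyp2F1_fps a b c) n" for n
      by (induction n) (simp_all only: ode_iff hyp2F1_fps_Suc assms(2) fps_hypergeo_0)
    then show "y = hyp2F1_fps a b c"
      by (rule fps_ext)
  next
    assume "y = hyp2F1_fps a b c"
    then show "hyp2F1_ode a b c y = 0"
      unfolding ode_iff by (simp only: hyp2F1_fps_Suc simp_thms)
  qed
qed

lemma fps_deriv_hypergeo_1F0:
  "(1 - fps_X) * fps_deriv (fps_hypergeo [s] [] 1) = fps_const s * fps_hypergeo [s] [] 1"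
proof (rule fps_ext)
  fix n
  let ?B = "fps_hypergeo [s] [] 1"
  have "of_nat (Suc n) * fps_nth ?B (Suc n) = (s + of_nat n) * fps_nth ?B n"
    unfolding fps_hypergeo_rec by (simp del: of_nat_Suc fps_hypergeo_nth)
  moreover have "(1 - fps_X) * fps_deriv ?B = fps_deriv ?B - fps_X * fps_deriv ?B"
    by (simp add: left_diff_distrib)
  ultimately show "fps_nth ((1 - fps_X) * fps_deriv ?B) n = fps_nth (fps_const s * ?B) n"
    by (cases n) (simp_all add: distrib_right del: of_nat_Suc fps_hypergeo_nth)
qed

text \<open>The hypothesis says that \<open>B\<close> is a multiple of \<open>(1 - X)\<^bsup>c-a-b\<^esup>\<close>.\<close>
lemma hyp2F1_ode_mult:
  assumes "(1 - fps_X) * fps_deriv B = fps_const (a + b - c) * B"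
  shows "hyp2F1_ode a b c (B * H) = B * hyp2F1_ode (c - a) (c - b) c H"
proof -
  define \<sigma> where "\<sigma> = fps_const (a + b - c)"
  define M where "M = fps_const c - (fps_const a + fps_const b + 1) * fps_X"
  note deriv_B = assms[folded \<sigma>_def]
  have "fps_deriv ((1 - fps_X) * fps_deriv B) = fps_deriv (\<sigma> * B)"
    by (simp only: deriv_B)
  then have deriv2_B: "(1 - fps_X) * fps_deriv (fps_deriv B) = (1 + \<sigma>) * fps_deriv B"
    by (simp add: \<sigma>_def algebra_simps)
  have "hyp2F1_ode a b c (B * H) =
      (fps_X * ((1 - fps_X) * fps_deriv (fps_deriv B)) + M * fps_deriv B) * H
      + (2 * fps_X * ((1 - fps_X) * fps_deriv B) + M * B) * fps_deriv H
      + fps_X * (1 - fps_X) * B * fps_deriv (fps_deriv H) - fps_const a * fps_const b * (B * H)"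
    unfolding hyp2F1_ode_def M_def[symmetric] by (simp add: algebra_simps)
  also have "fps_X * ((1 - fps_X) * fps_deriv (fps_deriv B)) + M * fps_deriv B =
      fps_const c * ((1 - fps_X) * fps_deriv B)"
    unfolding deriv2_B by (simp add: M_def \<sigma>_def algebra_simps flip: fps_const_add fps_const_sub)
  finally show ?thesis
    unfolding deriv_B
    by (simp add: hyp2F1_ode_def M_def \<sigma>_def algebra_simps flip: fps_const_add fps_const_sub)
qed

lemma hyp2F1_fps_euler_transform:
  assumes "c \<notin> \<int>\<^sub>\<le>\<^sub>0"
  shows "hyp2F1_fps a b c = fps_hypergeo [a + b - c] [] 1 * hyp2F1_fps (c - a) (c - b) c"
  using assms hyp2F1_ode_mult[OF fps_deriv_hypergeo_1F0, of a b c "hyp2F1_fps (c - a) (c - b) c"]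
    hyp2F1_ode_eq_0_iff[of c "hyp2F1_fps (c - a) (c - b) c" "c - a" "c - b"]
    hyp2F1_ode_eq_0_iff[of c "fps_hypergeo [a + b - c] [] 1 * hyp2F1_fps (c - a) (c - b) c" a b]
  by simp

lemma has_fps_expansion_one_minus_powr:
  "(\<lambda>z. (1 - z) powr (- a)) has_fps_expansion fps_hypergeo [a] [] (1 :: complex)"
  using binomial_series_one_minus_powr[of _ a] by (intro has_fps_expansion_unit_discI) simp

lemma hyp2F1_euler_transform:
  assumes c_not_nonpos: "c \<notin> \<int>\<^sub>\<le>\<^sub>0" and "z \<in> hyp2F1_domain"
  shows "hyp2F1 a b c z = (1 - z) powr (c - a - b) * hyp2F1 (c - a) (c - b) c z"
proof (rule hyp2F1_eqI[OF _ assms(2)])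
  have "hyp2F1 (c - a) (c - b) c holomorphic_on hyp2F1_domain"
    and "hyp2F1 (c - a) (c - b) c has_fps_expansion hyp2F1_fps (c - a) (c - b) c"
    using is_hyp2F1_hyp2F1[OF c_not_nonpos] by (simp_all only: is_hyp2F1_iff_has_fps_expansion)
  moreover have "(\<lambda>z. (1 - z) powr (c - a - b)) holomorphic_on hyp2F1_domain"
    using one_minus_mult_notin_nonpos_Reals[of _ 1] by (intro holomorphic_intros) auto
  moreover have "(\<lambda>z. (1 - z) powr (c - a - b)) has_fps_expansion fps_hypergeo [a + b - c] [] 1"
    using has_fps_expansion_one_minus_powr[of "a + b - c"] by (simp add: diff_diff_eq)
  ultimately show "is_hyp2F1 a b c (\<lambda>z. (1 - z) powr (c - a - b) * hyp2F1 (c - a) (c - b) c z)"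
    unfolding is_hyp2F1_iff_has_fps_expansion hyp2F1_fps_euler_transform[OF c_not_nonpos, of a b]
    by (intro conjI holomorphic_on_mult has_fps_expansion_mult)
qed

subsection \<open>The Weyl fractional integral\<close>

definition weyl_kernel :: "complex \<Rightarrow> real \<Rightarrow> complex" where
  "weyl_kernel \<mu> t = pos_powr (\<mu> - 1) t / Gamma \<mu>"

definition has_weyl_integral :: "complex \<Rightarrow> (real \<Rightarrow> complex) \<Rightarrow> real \<Rightarrow> complex \<Rightarrow> bool" where
  "has_weyl_integral \<mu> f x v \<longleftrightarrow> has_bochner_integral lborel (\<lambda>y. f y * weyl_kernel \<mu> (x - y)) v"

lemma borel_measurable_weyl_kernel [measurable]: "weyl_kernel \<mu> \<in> borel_measurable borel"
  unfolding weyl_kernel_def by measurable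

lemma weyl_kernel_nonpos: "t \<le> 0 \<Longrightarrow> weyl_kernel \<mu> t = 0"
  by (simp add: weyl_kernel_def pos_powr_nonpos)

lemma of_real_norm_weyl_kernel:
  assumes "Re \<mu> > 0"
  shows "complex_of_real (norm (weyl_kernel \<mu> t)) =
    of_real (Gamma (Re \<mu>) / norm (Gamma \<mu>)) * weyl_kernel (Re \<mu>) t"
  using Gamma_real_pos[OF assms]
  by (simp add: weyl_kernel_def norm_divide of_real_norm_pos_powr Gamma_complex_of_real)

lemma weyl_kernel_plus1:
  assumes "\<mu> \<notin> \<int>\<^sub>\<le>\<^sub>0"
  shows "\<mu> * weyl_kernel (\<mu> + 1) t = of_real t * weyl_kernel \<mu> t"
proof (cases "t > 0")
  case True
  moreover have "\<mu> \<noteq> 0"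
    using assms by auto
  ultimately show ?thesis
    using pos_powr_add[of "\<mu> - 1" 1 t]
    by (simp add: weyl_kernel_def Gamma_plus1[OF assms] pos_powr_pos)
qed (simp add: weyl_kernel_nonpos)

lemma has_weyl_integral_iff_set_integral:
  "has_weyl_integral \<mu> f x v \<longleftrightarrow>
     set_integrable lborel {..<x} (\<lambda>y. f y * (complex_of_real (x - y) powr (\<mu> - 1) / Gamma \<mu>)) \<and>
     (LBINT y:{..<x}. f y * (complex_of_real (x - y) powr (\<mu> - 1) / Gamma \<mu>)) = v"
proof -
  have "f y * weyl_kernel \<mu> (x - y) =
      indicator {..<x} y *\<^sub>R (f y * (complex_of_real (x - y) powr (\<mu> - 1) / Gamma \<mu>))" for y
    by (simp add: weyl_kernel_def pos_powr_def)
  then show ?thesis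
    unfolding has_weyl_integral_def set_integrable_def set_lebesgue_integral_def
    by (simp only: has_bochner_integral_iff)
qed

lemma has_weyl_integral_cong:
  assumes "\<And>y. y < x \<Longrightarrow> f y = g y"
  shows "has_weyl_integral \<mu> f x v \<longleftrightarrow> has_weyl_integral \<mu> g x v"
proof -
  have "f y * weyl_kernel \<mu> (x - y) = g y * weyl_kernel \<mu> (x - y)" for y
    using assms[of y] by (cases "y < x") (simp_all add: weyl_kernel_nonpos)
  then show ?thesis
    by (simp only: has_weyl_integral_def)
qed

lemma has_weyl_integral_add:
  "has_weyl_integral \<mu> f x v \<Longrightarrow> has_weyl_integral \<mu> g x w \<Longrightarrow>
    has_weyl_integral \<mu> (\<lambda>y. f y + g y) x (v + w)"
  unfolding has_weyl_integral_def distrib_right by (rule has_bochner_integral_add)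

lemma has_weyl_integral_cmult:
  "has_weyl_integral \<mu> f x v \<Longrightarrow> has_weyl_integral \<mu> (\<lambda>y. k * f y) x (k * v)"
  unfolding has_weyl_integral_def mult.assoc by (rule has_bochner_integral_mult_right)

text \<open>Write \<open>y = x - (x - y)\<close>; the factor \<open>x - y\<close> raises the order of integration by one.\<close>
lemma has_weyl_integral_mult_ident:
  assumes "has_weyl_integral \<mu> f x v" and "has_weyl_integral (\<mu> + 1) f x w" and "\<mu> \<notin> \<int>\<^sub>\<le>\<^sub>0"
  shows "has_weyl_integral \<mu> (\<lambda>y. of_real y * f y) x (of_real x * v - \<mu> * w)"
proof -
  have "has_bochner_integral lborel
      (\<lambda>y. of_real x * (f y * weyl_kernel \<mu> (x - y)) - \<mu> * (f y * weyl_kernel (\<mu> + 1) (x - y)))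
      (of_real x * v - \<mu> * w)"
    using assms(1,2) unfolding has_weyl_integral_def
    by (intro has_bochner_integral_diff has_bochner_integral_mult_right)
  also have "(\<lambda>y. of_real x * (f y * weyl_kernel \<mu> (x - y)) - \<mu> * (f y * weyl_kernel (\<mu> + 1) (x - y))) =
      (\<lambda>y. of_real y * f y * weyl_kernel \<mu> (x - y))"
    by (simp add: mult.left_commute[of \<mu>] weyl_kernel_plus1[OF assms(3)]) (simp add: algebra_simps)
  finally show ?thesis
    unfolding has_weyl_integral_def .
qed

lemma has_weyl_integral_integral:
  fixes f :: "'a \<Rightarrow> real \<Rightarrow> complex"
  assumes "sigma_finite_measure M" and [measurable]: "case_prod f \<in> borel_measurable (M \<Otimes>\<^sub>M lborel)"
    and "Re \<mu> > 0"
    and weyl: "\<And>u. u \<in> space M \<Longrightarrow> has_weyl_integral \<mu> (f u) x (g u)"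
    and weyl_norm: "\<And>u. u \<in> space M \<Longrightarrow> has_weyl_integral (Re \<mu>) (\<lambda>y. of_real (norm (f u y))) x (N u)"
      "integrable M N"
    and integrable: "\<And>y. y < x \<Longrightarrow> integrable M (\<lambda>u. f u y)"
    and iterated: "has_bochner_integral M g v"
  shows "has_weyl_integral \<mu> (\<lambda>y. \<integral>u. f u y \<partial>M) x v"
  unfolding has_weyl_integral_def
proof -
  interpret M: sigma_finite_measure M by fact
  interpret pair_sigma_finite M lborel ..
  define C where "C = complex_of_real (Gamma (Re \<mu>) / norm (Gamma \<mu>))"
  show "has_bochner_integral lborel (\<lambda>y. (\<integral>u. f u y \<partial>M) * weyl_kernel \<mu> (x - y)) v"
  proof (rule has_bochner_integral_Fubini[of "\<lambda>u y. f u y * weyl_kernel \<mu> (x - y)"])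
    show "(\<lambda>(u, y). f u y * weyl_kernel \<mu> (x - y)) \<in> borel_measurable (M \<Otimes>\<^sub>M lborel)"
      by measurable
    fix u assume u: "u \<in> space M"
    show "has_bochner_integral lborel (\<lambda>y. f u y * weyl_kernel \<mu> (x - y)) (g u)"
      using weyl[OF u] by (simp only: has_weyl_integral_def)
    have "complex_of_real (norm (f u y * weyl_kernel \<mu> (x - y))) =
        C * (of_real (norm (f u y)) * weyl_kernel (Re \<mu>) (x - y))" for y
      unfolding norm_mult of_real_mult of_real_norm_weyl_kernel[OF \<open>Re \<mu> > 0\<close>] C_def
      by (simp only: mult_ac)
    then have "has_bochner_integral lborel
        (\<lambda>y. complex_of_real (norm (f u y * weyl_kernel \<mu> (x - y)))) (C * N u)"
      using weyl_norm(1)[OF u] unfolding has_weyl_integral_def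
      by (simp only: has_bochner_integral_mult_right)
    then show "has_bochner_integral lborel (\<lambda>y. norm (f u y * weyl_kernel \<mu> (x - y))) (Re (C * N u))"
      by (rule has_bochner_integral_of_real_D)
  next
    show "integrable M (\<lambda>u. Re (C * N u))"
      using weyl_norm(2) by simp
    show "has_bochner_integral M (\<lambda>u. f u y * weyl_kernel \<mu> (x - y))
        ((\<integral>u. f u y \<partial>M) * weyl_kernel \<mu> (x - y))" for y
      using integrable[of y]
      by (cases "y < x") (simp_all add: weyl_kernel_nonpos has_bochner_integral_iff)
  qed (fact iterated)
qed

lemma has_weyl_integral_one_minus_mult_powr:
  assumes "Re \<mu> > 0" "Re \<alpha> > Re \<mu>" "t > 0" "x * t < 1"
  shows "has_weyl_integral \<mu> (\<lambda>y. pos_powr (- \<alpha>) (1 - y * t)) x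
    (Gamma (\<alpha> - \<mu>) / Gamma \<alpha> * (pos_powr (- \<mu>) t * pos_powr (- (\<alpha> - \<mu>)) (1 - x * t)))"
proof -
  define f where "f v = pos_powr (\<mu> - 1) v * pos_powr (- \<alpha>) ((1 - x * t) + t * v) / Gamma \<mu>" for v
  have "has_bochner_integral lborel f
      (Beta \<mu> (\<alpha> - \<mu>) * (pos_powr (- \<mu>) t * pos_powr (- (\<alpha> - \<mu>)) (1 - x * t)) / Gamma \<mu>)"
    unfolding f_def using assms has_bochner_integral_Beta[of \<mu> "\<alpha> - \<mu>" t "1 - x * t"]
    by (intro has_bochner_integral_divide) auto
  then have "has_bochner_integral lborel (\<lambda>y. f (x + (- 1) * y))
      (Beta \<mu> (\<alpha> - \<mu>) * (pos_powr (- \<mu>) t * pos_powr (- (\<alpha> - \<mu>)) (1 - x * t)) / Gamma \<mu>)"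
    by (subst (asm) lborel_has_bochner_integral_real_affine_iff[of "- 1" _ _ x]) simp_all
  moreover have "f (x + (- 1) * y) = pos_powr (- \<alpha>) (1 - y * t) * weyl_kernel \<mu> (x - y)" for y
    by (simp add: f_def weyl_kernel_def algebra_simps)
  ultimately show ?thesis
    using Gamma_neq_0_Re_pos[OF assms(1)] by (simp add: has_weyl_integral_def Beta_def)
qed

subsection \<open>The Weyl fractional integral of a hypergeometric function\<close>

definition weyl_factor :: "complex \<Rightarrow> complex \<Rightarrow> complex \<Rightarrow> complex \<Rightarrow> complex" where
  "weyl_factor \<mu> \<alpha> \<beta> c =
     Gamma (\<alpha> - \<mu>) / Gamma \<alpha> * (Gamma (\<beta> - \<mu>) / Gamma \<beta>) * (Gamma c / Gamma (c - \<mu>))"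

lemma one_minus_mult_pos: "y < 1 \<Longrightarrow> t \<in> {0..1} \<Longrightarrow> 1 - y * t > 0" for y t :: real
  using mult_right_mono[of y 1 t] by (cases "t = 1") auto

lemma has_weyl_integral_euler_kernel:
  assumes "Re \<mu> > 0" "Re \<alpha> > Re \<mu>" "x < 1"
  shows "has_weyl_integral \<mu> (\<lambda>y. euler_weight \<beta> c u * pos_powr (- \<alpha>) (1 - y * euler_ratio u)) x
    (Gamma (\<alpha> - \<mu>) / Gamma \<alpha> *
      (euler_weight (\<beta> - \<mu>) (c - \<mu>) u * pos_powr (- (\<alpha> - \<mu>)) (1 - x * euler_ratio u)))"
proof (cases "u > 0")
  case True
  then have "euler_ratio u > 0" "x * euler_ratio u < 1"
    using one_minus_mult_pos[OF assms(3) euler_ratio_in_unit_interval, of u]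
    by (auto simp: euler_ratio_def)
  from has_weyl_integral_cmult[OF has_weyl_integral_one_minus_mult_powr[OF assms(1,2) this],
      of "euler_weight \<beta> c u"]
  show ?thesis
    using euler_weight_mult_pos_powr_ratio[of \<beta> c u "- \<mu>"]
    by (simp add: mult.left_commute flip: mult.assoc)
qed (simp add: has_weyl_integral_def euler_weight_def pos_powr_nonpos has_bochner_integral_zero)

lemma euler_integral_of_real:
  assumes "y < 1"
  shows "euler_integral a b c (of_real y) =
    (\<integral>u. euler_weight b c u * pos_powr (- a) (1 - y * euler_ratio u) \<partial>lborel) / Beta b (c - b)"
  using one_minus_mult_pos[OF assms euler_ratio_in_unit_interval]
  by (simp add: euler_integral_def pos_powr_pos)

lemma integrable_euler_kernel_of_real:
  assumes "Re b > 0" "Re c > Re b" "y < 1"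
  shows "integrable lborel (\<lambda>u. euler_weight b c u * pos_powr (- a) (1 - y * euler_ratio u))"
  using integrable_one_minus_mult_powr[OF integrable_euler_weight[OF assms(1,2)] _ _
      of_real_in_hyp2F1_domain[OF assms(3)], of euler_ratio "- a"]
    euler_ratio_in_unit_interval one_minus_mult_pos[OF assms(3) euler_ratio_in_unit_interval]
  by (simp add: pos_powr_pos)

lemma has_weyl_integral_euler_integral:
  assumes Re_less: "Re \<mu> > 0" "Re \<alpha> > Re \<mu>" "Re \<beta> > Re \<mu>" and "Re c > Re \<beta>" "x < 1"
  shows "has_weyl_integral \<mu> (\<lambda>y. euler_integral \<alpha> \<beta> c (of_real y)) x
    (weyl_factor \<mu> \<alpha> \<beta> c * euler_integral (\<alpha> - \<mu>) (\<beta> - \<mu>) (c - \<mu>) (of_real x))"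
proof -
  define f where "f \<alpha> \<beta> c u y = euler_weight \<beta> c u * pos_powr (- \<alpha>) (1 - y * euler_ratio u)"
    for \<alpha> \<beta> c u y
  define g where "g \<mu> \<alpha> \<beta> c u = Gamma (\<alpha> - \<mu>) / Gamma \<alpha> * f (\<alpha> - \<mu>) (\<beta> - \<mu>) (c - \<mu>) u x"
    for \<mu> \<alpha> \<beta> c u
  have integrable_f: "integrable lborel (\<lambda>u. f \<alpha> \<beta> c u y)"
    if "Re \<beta> > 0" "Re c > Re \<beta>" "y < 1" for \<alpha> \<beta> c y
    unfolding f_def using that by (rule integrable_euler_kernel_of_real)
  have weyl_f: "has_weyl_integral \<mu> (f \<alpha> \<beta> c u) x (g \<mu> \<alpha> \<beta> c u)"
    if "Re \<mu> > 0" "Re \<alpha> > Re \<mu>" for \<mu> \<alpha> \<beta> c u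
    unfolding f_def[abs_def] g_def using that \<open>x < 1\<close> by (rule has_weyl_integral_euler_kernel)
  have norm_f: "complex_of_real (norm (f \<alpha> \<beta> c u y)) = f (Re \<alpha>) (Re \<beta>) (Re c) u y" for u y
    by (simp add: f_def euler_weight_def norm_mult of_real_norm_pos_powr)
  have "has_weyl_integral \<mu> (\<lambda>y. \<integral>u. f \<alpha> \<beta> c u y \<partial>lborel) x (integral\<^sup>L lborel (g \<mu> \<alpha> \<beta> c))"
  proof (rule has_weyl_integral_integral[OF _ _ Re_less(1) weyl_f[OF Re_less(1,2)]])
    show "case_prod (f \<alpha> \<beta> c) \<in> borel_measurable (lborel \<Otimes>\<^sub>M lborel)"
      unfolding f_def by measurable
    show "has_weyl_integral (Re \<mu>) (\<lambda>y. complex_of_real (norm (f \<alpha> \<beta> c u y))) x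
        (g (Re \<mu>) (Re \<alpha>) (Re \<beta>) (Re c) u)" for u
      unfolding norm_f using Re_less by (intro weyl_f) auto
    show "integrable lborel (g (Re \<mu>) (Re \<alpha>) (Re \<beta>) (Re c))"
      unfolding g_def using assms by (intro integrable_mult_right integrable_f) auto
    show "has_bochner_integral lborel (g \<mu> \<alpha> \<beta> c) (integral\<^sup>L lborel (g \<mu> \<alpha> \<beta> c))"
      unfolding has_bochner_integral_iff g_def using assms
      by (intro conjI refl integrable_mult_right integrable_f) auto
  qed (use assms in \<open>auto intro: integrable_f lborel.sigma_finite_measure_axioms\<close>)
  from has_weyl_integral_cmult[OF this, of "1 / Beta \<beta> (c - \<beta>)"]
  have "has_weyl_integral \<mu> (\<lambda>y. euler_integral \<alpha> \<beta> c (of_real y)) x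
      (integral\<^sup>L lborel (g \<mu> \<alpha> \<beta> c) / Beta \<beta> (c - \<beta>))"
    using \<open>x < 1\<close> by (subst has_weyl_integral_cong) (simp_all add: euler_integral_of_real f_def)
  moreover have "integral\<^sup>L lborel (g \<mu> \<alpha> \<beta> c) / Beta \<beta> (c - \<beta>) =
      weyl_factor \<mu> \<alpha> \<beta> c * euler_integral (\<alpha> - \<mu>) (\<beta> - \<mu>) (c - \<mu>) (of_real x)"
    using assms
    by (simp add: g_def[abs_def] f_def euler_integral_of_real weyl_factor_def Beta_def
        Gamma_neq_0_Re_pos)
  ultimately show ?thesis
    by simp
qed

lemma Gamma_plus2: "z \<notin> \<int>\<^sub>\<le>\<^sub>0 \<Longrightarrow> Gamma (z + 2) = (z + 1) * (z * Gamma z)" for z :: "'a :: Gamma"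
  using Gamma_plus1[of "z + 1"] not_nonpos_Ints_plus1[of z] by (simp add: Gamma_plus1 add.assoc)

lemma weyl_factor_raise:
  assumes "c \<notin> \<int>\<^sub>\<le>\<^sub>0" "c - \<mu> \<notin> \<int>\<^sub>\<le>\<^sub>0" "\<alpha> \<notin> \<int>\<^sub>\<le>\<^sub>0" "\<beta> \<notin> \<int>\<^sub>\<le>\<^sub>0" "\<alpha> - \<mu> \<notin> \<int>\<^sub>\<le>\<^sub>0" "\<beta> - \<mu> \<notin> \<int>\<^sub>\<le>\<^sub>0"
  shows "\<alpha> * \<beta> / (c * (c + 1)) * weyl_factor \<mu> (\<alpha> + 1) (\<beta> + 1) (c + 2) =
    (\<alpha> - \<mu>) * (\<beta> - \<mu>) / ((c - \<mu>) * (c - \<mu> + 1)) * weyl_factor \<mu> \<alpha> \<beta> c"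
proof -
  have shifts: "\<alpha> + 1 - \<mu> = \<alpha> - \<mu> + 1" "\<beta> + 1 - \<mu> = \<beta> - \<mu> + 1" "c + 2 - \<mu> = c - \<mu> + 2"
    by simp_all
  have "c \<noteq> 0" "c + 1 \<noteq> 0" "\<alpha> \<noteq> 0" "\<beta> \<noteq> 0" "c - \<mu> \<noteq> 0" "c - \<mu> + 1 \<noteq> 0"
    using assms not_nonpos_Ints_plus1[OF assms(1)] not_nonpos_Ints_plus1[OF assms(2)] by auto
  then show ?thesis
    unfolding weyl_factor_def shifts using assms by (simp add: Gamma_plus1 Gamma_plus2 mult_ac)
qed

lemma weyl_factor_contiguous:
  assumes "c \<notin> \<int>\<^sub>\<le>\<^sub>0" "c - \<mu> \<notin> \<int>\<^sub>\<le>\<^sub>0" "\<alpha> \<notin> \<int>\<^sub>\<le>\<^sub>0" "\<beta> \<notin> \<int>\<^sub>\<le>\<^sub>0"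
  shows "weyl_factor \<mu> \<alpha> \<beta> (c + 1)
    - \<mu> * (\<alpha> * \<beta> / (c * (c + 1)) * weyl_factor (\<mu> + 1) (\<alpha> + 1) (\<beta> + 1) (c + 2)) = weyl_factor \<mu> \<alpha> \<beta> c"
proof -
  let ?W = "weyl_factor \<mu> \<alpha> \<beta> c"
  have shifts: "c + 1 - \<mu> = c - \<mu> + 1" "\<alpha> + 1 - (\<mu> + 1) = \<alpha> - \<mu>" "\<beta> + 1 - (\<mu> + 1) = \<beta> - \<mu>"
    "c + 2 - (\<mu> + 1) = c - \<mu> + 1"
    by simp_all
  have neq_0: "c \<noteq> 0" "c + 1 \<noteq> 0" "\<alpha> \<noteq> 0" "\<beta> \<noteq> 0" "c - \<mu> \<noteq> 0"
    using assms not_nonpos_Ints_plus1[OF assms(1)] by auto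
  have "weyl_factor \<mu> \<alpha> \<beta> (c + 1) = c / (c - \<mu>) * ?W"
    unfolding weyl_factor_def shifts using assms by (simp add: Gamma_plus1 mult_ac)
  moreover have "\<alpha> * \<beta> / (c * (c + 1)) * weyl_factor (\<mu> + 1) (\<alpha> + 1) (\<beta> + 1) (c + 2) = ?W / (c - \<mu>)"
    unfolding weyl_factor_def shifts using assms neq_0 by (simp add: Gamma_plus1 Gamma_plus2 mult_ac)
  moreover have "c / (c - \<mu>) * ?W - \<mu> * (?W / (c - \<mu>)) = ?W"
    using neq_0(5) by (simp flip: diff_divide_distrib left_diff_distrib)
  ultimately show ?thesis
    by (simp only:)
qed

definition weyl_formula :: "real \<Rightarrow> complex \<Rightarrow> complex \<Rightarrow> complex \<Rightarrow> complex \<Rightarrow> bool" where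
  "weyl_formula x \<mu> \<alpha> \<beta> c \<longleftrightarrow>
     has_weyl_integral \<mu> (\<lambda>y. hyp2F1 \<alpha> \<beta> c (of_real y)) x
       (weyl_factor \<mu> \<alpha> \<beta> c * hyp2F1 (\<alpha> - \<mu>) (\<beta> - \<mu>) (c - \<mu>) (of_real x))"

lemma weyl_formula_Re_less:
  assumes "Re \<mu> > 0" "Re \<alpha> > Re \<mu>" "Re \<beta> > Re \<mu>" "Re c > Re \<beta>" "x < 1"
  shows "weyl_formula x \<mu> \<alpha> \<beta> c"
proof -
  have euler: "hyp2F1 \<alpha> \<beta> c (of_real y) = euler_integral \<alpha> \<beta> c (of_real y)"
    if "Re \<beta> > 0" "Re c > Re \<beta>" "y < 1" for \<alpha> \<beta> c y
    using that by (intro hyp2F1_eqI is_hyp2F1_euler_integral of_real_in_hyp2F1_domain)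
  have "has_weyl_integral \<mu> (\<lambda>y. hyp2F1 \<alpha> \<beta> c (of_real y)) x v \<longleftrightarrow>
      has_weyl_integral \<mu> (\<lambda>y. euler_integral \<alpha> \<beta> c (of_real y)) x v" for v
    using assms by (intro has_weyl_integral_cong euler) auto
  then show ?thesis
    using has_weyl_integral_euler_integral[OF assms] assms by (simp add: weyl_formula_def euler)
qed

lemma has_weyl_integral_hyp2F1_contiguous:
  assumes "c \<notin> \<int>\<^sub>\<le>\<^sub>0" "\<mu> \<notin> \<int>\<^sub>\<le>\<^sub>0" "x < 1"
    and "has_weyl_integral \<mu> (\<lambda>y. hyp2F1 \<alpha> \<beta> (c + 1) (of_real y)) x u"
    and "has_weyl_integral \<mu> (\<lambda>y. hyp2F1 (\<alpha> + 1) (\<beta> + 1) (c + 2) (of_real y)) x v"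
    and "has_weyl_integral (\<mu> + 1) (\<lambda>y. hyp2F1 (\<alpha> + 1) (\<beta> + 1) (c + 2) (of_real y)) x w"
  shows "has_weyl_integral \<mu> (\<lambda>y. hyp2F1 \<alpha> \<beta> c (of_real y)) x
    (u + \<alpha> * \<beta> / (c * (c + 1)) * (of_real x * v - \<mu> * w))"
proof -
  define \<kappa> where "\<kappa> = \<alpha> * \<beta> / (c * (c + 1))"
  have "hyp2F1 \<alpha> \<beta> c (of_real y) = hyp2F1 \<alpha> \<beta> (c + 1) (of_real y)
      + \<kappa> * (of_real y * hyp2F1 (\<alpha> + 1) (\<beta> + 1) (c + 2) (of_real y))" if "y < x" for y
    using hyp2F1_raise_c[OF assms(1) of_real_in_hyp2F1_domain[of y], of \<alpha> \<beta>] that \<open>x < 1\<close>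
    by (simp add: \<kappa>_def mult.assoc)
  then show ?thesis
    unfolding \<kappa>_def[symmetric] using assms
    by (subst has_weyl_integral_cong)
       (auto intro!: has_weyl_integral_add has_weyl_integral_cmult has_weyl_integral_mult_ident)
qed

lemma weyl_formula_contiguous:
  assumes Re_less: "Re \<mu> > 0" "Re \<alpha> > Re \<mu>" "Re \<beta> > Re \<mu>"
    and c_not_nonpos: "c \<notin> \<int>\<^sub>\<le>\<^sub>0" "c - \<mu> \<notin> \<int>\<^sub>\<le>\<^sub>0" and "x < 1"
    and formulas: "weyl_formula x \<mu> \<alpha> \<beta> (c + 1)" "weyl_formula x \<mu> (\<alpha> + 1) (\<beta> + 1) (c + 2)"
      "weyl_formula x (\<mu> + 1) (\<alpha> + 1) (\<beta> + 1) (c + 2)"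
  shows "weyl_formula x \<mu> \<alpha> \<beta> c"
  unfolding weyl_formula_def
proof -
  define \<kappa> where "\<kappa> = \<alpha> * \<beta> / (c * (c + 1))"
  define \<kappa>' where "\<kappa>' = (\<alpha> - \<mu>) * (\<beta> - \<mu>) / ((c - \<mu>) * (c - \<mu> + 1))"
  define \<Phi> where "\<Phi> = hyp2F1 (\<alpha> - \<mu>) (\<beta> - \<mu>) (c - \<mu> + 1) (of_real x)"
  define \<Phi>' where "\<Phi>' = hyp2F1 (\<alpha> - \<mu> + 1) (\<beta> - \<mu> + 1) (c - \<mu> + 2) (of_real x)"
  let ?W = weyl_factor
  have not_nonpos_Ints: "\<alpha> \<notin> \<int>\<^sub>\<le>\<^sub>0" "\<beta> \<notin> \<int>\<^sub>\<le>\<^sub>0" "\<alpha> - \<mu> \<notin> \<int>\<^sub>\<le>\<^sub>0" "\<beta> - \<mu> \<notin> \<int>\<^sub>\<le>\<^sub>0" "\<mu> \<notin> \<int>\<^sub>\<le>\<^sub>0"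
    using Re_less by (auto intro!: Re_pos_imp_not_nonpos_Ints)
  have "has_weyl_integral \<mu> (\<lambda>y. hyp2F1 \<alpha> \<beta> c (of_real y)) x (?W \<mu> \<alpha> \<beta> (c + 1) * \<Phi>
      + \<kappa> * (of_real x * (?W \<mu> (\<alpha> + 1) (\<beta> + 1) (c + 2) * \<Phi>')
           - \<mu> * (?W (\<mu> + 1) (\<alpha> + 1) (\<beta> + 1) (c + 2) * \<Phi>)))"
    unfolding \<kappa>_def using formulas unfolding weyl_formula_def \<Phi>_def \<Phi>'_def
    by (intro has_weyl_integral_hyp2F1_contiguous c_not_nonpos not_nonpos_Ints \<open>x < 1\<close>)
       (simp_all add: algebra_simps)
  also have "?W \<mu> \<alpha> \<beta> (c + 1) * \<Phi>
      + \<kappa> * (of_real x * (?W \<mu> (\<alpha> + 1) (\<beta> + 1) (c + 2) * \<Phi>')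
           - \<mu> * (?W (\<mu> + 1) (\<alpha> + 1) (\<beta> + 1) (c + 2) * \<Phi>)) =
      (?W \<mu> \<alpha> \<beta> (c + 1) - \<mu> * (\<kappa> * ?W (\<mu> + 1) (\<alpha> + 1) (\<beta> + 1) (c + 2))) * \<Phi>
      + of_real x * (\<kappa> * ?W \<mu> (\<alpha> + 1) (\<beta> + 1) (c + 2)) * \<Phi>'"
    by (simp add: algebra_simps)
  also have "\<dots> = ?W \<mu> \<alpha> \<beta> c * (\<Phi> + \<kappa>' * of_real x * \<Phi>')"
    unfolding \<kappa>_def \<kappa>'_def weyl_factor_raise[OF c_not_nonpos not_nonpos_Ints(1-4)]
      weyl_factor_contiguous[OF c_not_nonpos not_nonpos_Ints(1-2)]
    by (simp add: distrib_left mult_ac)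
  also have "\<Phi> + \<kappa>' * of_real x * \<Phi>' = hyp2F1 (\<alpha> - \<mu>) (\<beta> - \<mu>) (c - \<mu>) (of_real x)"
    unfolding \<Phi>_def \<Phi>'_def \<kappa>'_def
    using c_not_nonpos(2) \<open>x < 1\<close> by (intro hyp2F1_raise_c[symmetric] of_real_in_hyp2F1_domain)
  finally show "has_weyl_integral \<mu> (\<lambda>y. hyp2F1 \<alpha> \<beta> c (of_real y)) x
      (weyl_factor \<mu> \<alpha> \<beta> c * hyp2F1 (\<alpha> - \<mu>) (\<beta> - \<mu>) (c - \<mu>) (of_real x))" .
qed

lemma has_weyl_integral_hyp2F1:
  assumes "Re \<mu> > 0" "Re \<alpha> > Re \<mu>" "Re \<beta> > Re \<mu>" "c \<notin> \<int>\<^sub>\<le>\<^sub>0" "c - \<mu> \<notin> \<int>\<^sub>\<le>\<^sub>0" "x < 1"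
  shows "has_weyl_integral \<mu> (\<lambda>y. hyp2F1 \<alpha> \<beta> c (of_real y)) x
    (weyl_factor \<mu> \<alpha> \<beta> c * hyp2F1 (\<alpha> - \<mu>) (\<beta> - \<mu>) (c - \<mu>) (of_real x))"
proof -
  obtain n where "Re \<beta> - Re c < real n"
    using reals_Archimedean2 by blast
  then have "Re \<beta> < Re c + real n"
    by simp
  then have "weyl_formula x \<mu> \<alpha> \<beta> c"
    using assms
  proof (induction n arbitrary: \<mu> \<alpha> \<beta> c)
    case 0
    then show ?case
      using weyl_formula_Re_less by simp
  next
    case (Suc n)
    have c_minus: "c + 1 - \<mu> \<notin> \<int>\<^sub>\<le>\<^sub>0" "c + 2 - \<mu> \<notin> \<int>\<^sub>\<le>\<^sub>0" "c + 2 - (\<mu> + 1) \<notin> \<int>\<^sub>\<le>\<^sub>0"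
      using not_nonpos_Ints_plus1[OF Suc.prems(6)] not_nonpos_Ints_plus2[OF Suc.prems(6)]
      by (simp_all add: algebra_simps)
    show ?case
      by (rule weyl_formula_contiguous[OF _ _ _ _ _ _ Suc.IH Suc.IH Suc.IH])
         (use Suc.prems c_minus in \<open>auto simp: not_nonpos_Ints_plus1 not_nonpos_Ints_plus2\<close>)
  qed
  then show ?thesis
    unfolding weyl_formula_def .
qed

lemma hyp2F1_euler_transform_of_real:
  assumes "c \<notin> \<int>\<^sub>\<le>\<^sub>0" "y < 1"
  shows "complex_of_real (1 - y) powr (a + b - c) * hyp2F1 a b c (of_real y) =
    hyp2F1 (c - a) (c - b) c (of_real y)"
proof -
  have "complex_of_real (1 - y) powr (a + b - c) * (1 - complex_of_real y) powr (c - a - b) = 1"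
    using assms(2) by (simp flip: powr_add)
  then show ?thesis
    using hyp2F1_euler_transform[OF assms(1) of_real_in_hyp2F1_domain[OF assms(2)], of a b]
    by (simp flip: mult.assoc)
qed

theorem mainTheorem5:
  fixes a b c \<mu> :: complex and x :: real
  assumes "c \<notin> \<int>\<^sub>\<le>\<^sub>0" and "c - \<mu> \<notin> \<int>\<^sub>\<le>\<^sub>0"
    and "Re \<mu> > 0"
    and "Re (c - a) > Re \<mu>" and "Re (c - b) > Re \<mu>"
    and "x < 1"
  shows "set_integrable lborel {..<x}
           (\<lambda>y. complex_of_real (1 - y) powr (a + b - c) * hyp2F1 a b c (complex_of_real y)
                * (complex_of_real (x - y) powr (\<mu> - 1) / Gamma \<mu>)) \<and>
         (LBINT y:{..<x}. complex_of_real (1 - y) powr (a + b - c) * hyp2F1 a b c (complex_of_real y)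
                * (complex_of_real (x - y) powr (\<mu> - 1) / Gamma \<mu>))
         = Gamma (c - a - \<mu>) / Gamma (c - a) * (Gamma (c - b - \<mu>) / Gamma (c - b))
           * (Gamma c / Gamma (c - \<mu>))
           * complex_of_real (1 - x) powr (a + b - c + \<mu>) * hyp2F1 a b (c - \<mu>) (complex_of_real x)"
proof -
  let ?f = "\<lambda>y. complex_of_real (1 - y) powr (a + b - c) * hyp2F1 a b c (of_real y)"
  have "has_weyl_integral \<mu> ?f x v \<longleftrightarrow>
      has_weyl_integral \<mu> (\<lambda>y. hyp2F1 (c - a) (c - b) c (of_real y)) x v" for v
    using assms by (intro has_weyl_integral_cong hyp2F1_euler_transform_of_real) auto
  then have "has_weyl_integral \<mu> ?f x
      (weyl_factor \<mu> (c - a) (c - b) c * hyp2F1 (c - a - \<mu>) (c - b - \<mu>) (c - \<mu>) (of_real x))"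
    using has_weyl_integral_hyp2F1[OF assms(3-5,1,2,6)] by (simp only:)
  also have "hyp2F1 (c - a - \<mu>) (c - b - \<mu>) (c - \<mu>) (of_real x) =
      complex_of_real (1 - x) powr (a + b - c + \<mu>) * hyp2F1 a b (c - \<mu>) (of_real x)"
    using hyp2F1_euler_transform_of_real[OF assms(2,6), of a b] by (simp add: algebra_simps)
  finally show ?thesis
    unfolding has_weyl_integral_iff_set_integral weyl_factor_def by (simp only: mult.assoc)
qed

end
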